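(* Let $\mathfrak S$ be a 2,3-split system on a multiset $\mathcal M$ in which every split has multiplicity $1$. Then $\mathfrak S$ is compatible if and only if every submultiset of $\mathfrak S$ of size at most $\Delta(\mathcal M)+3$ is compatible.
   Context: A multiset $\mathcal M$ has underlying set $X$; $\mathcal M(x)\ge 1$ is the multiplicity of $x\in X$, and $\Delta(\mathcal M)=\sum_{x\in X}(\mathcal M(x)-1)$. Unions, inclusions, differences and cardinalities are in the multiset sense. A split of $\mathcal M$ is an unordered pair $\{A,B\}$, written $A|B$, of nonempty submultisets with multiset union $\mathcal M$; $\overline A=\mathcal M-A$. The size of a split $A|\overline A$ is $\min\{|A|,|\overline A|\}$. A split system on $\mathcal M$ is a finite multiset of splits; a 2,3-split system is one in which every split has size $2$ or $3$. An $\mathcal M$-tree is a finite tree $T$ with a labeling $\lambda$ of vertices by submultisets of $\mathcal M$ such that the multiset union of all labels is $\mathcal M$ and every vertex of degree $1$ or $2$ has nonempty label. Each edge $e$ induces the split $A|B$ with $A$, $B$ the multiset unions of labels in the two components of $T-e$; the tree represents the multiset of splits induced by all its edges. A split system is compatible if some $\mathcal M$-tree represents it. *)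

theory Defs
  imports "HOL-Library.Multiset" "HOL-Library.Uprod"
begin

definition Delta :: "'a multiset \<Rightarrow> nat" where
  "Delta M = (\<Sum>x\<in>set_mset M. count M x - 1)"

subsection \<open>Splits and split systems\<close>

text \<open>A split is an unordered pair of multisets; the two parts may coincide.\<close>

definition is_split :: "'a multiset \<Rightarrow> 'a multiset uprod \<Rightarrow> bool" where
  "is_split M s \<longleftrightarrow> (\<exists>A B. s = Upair A B \<and> A \<noteq> {#} \<and> B \<noteq> {#} \<and> A + B = M)"

definition split_size :: "'a multiset uprod \<Rightarrow> nat" where
  "split_size s = Min (size ` set_uprod s)"

definition split_system :: "'a multiset \<Rightarrow> 'a multiset uprod multiset \<Rightarrow> bool" where
  "split_system M S \<longleftrightarrow> (\<forall>s\<in>#S. is_split M s)"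

definition split_system_23 :: "'a multiset \<Rightarrow> 'a multiset uprod multiset \<Rightarrow> bool" where
  "split_system_23 M S \<longleftrightarrow> split_system M S \<and> (\<forall>s\<in>#S. split_size s \<in> {2, 3})"

subsection \<open>Finite trees\<close>

text \<open>A simple graph is given by a vertex set and a set of edges, the edges being unordered
  pairs of distinct vertices.\<close>

definition graph :: "'v set \<Rightarrow> 'v uprod set \<Rightarrow> bool" where
  "graph V E \<longleftrightarrow> (\<forall>e\<in>E. proper_uprod e \<and> set_uprod e \<subseteq> V)"

definition adjacency :: "'v uprod set \<Rightarrow> ('v \<times> 'v) set" where
  "adjacency E = {(u, v). Upair u v \<in> E}"

definition component :: "'v set \<Rightarrow> 'v uprod set \<Rightarrow> 'v \<Rightarrow> 'v set" where
  "component V E v = {u \<in> V. (v, u) \<in> (adjacency E)\<^sup>*}"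

definition connected_graph :: "'v set \<Rightarrow> 'v uprod set \<Rightarrow> bool" where
  "connected_graph V E \<longleftrightarrow> V \<noteq> {} \<and> (\<forall>u\<in>V. \<forall>v\<in>V. (u, v) \<in> (adjacency E)\<^sup>*)"

definition is_cycle :: "'v uprod set \<Rightarrow> 'v list \<Rightarrow> bool" where
  "is_cycle E p \<longleftrightarrow> length p \<ge> 3 \<and> distinct p
     \<and> successively (\<lambda>u v. Upair u v \<in> E) p \<and> Upair (last p) (hd p) \<in> E"

definition finite_tree :: "'v set \<Rightarrow> 'v uprod set \<Rightarrow> bool" where
  "finite_tree V E \<longleftrightarrow> finite V \<and> graph V E \<and> connected_graph V E \<and> \<not> (\<exists>p. is_cycle E p)"

definition degree :: "'v uprod set \<Rightarrow> 'v \<Rightarrow> nat" where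
  "degree E v = card {e \<in> E. v \<in> set_uprod e}"

subsection \<open>Labelled trees and compatibility\<close>

text \<open>The labels are automatically submultisets of \<open>M\<close>, since they sum up to \<open>M\<close>.\<close>

definition M_tree ::
  "'a multiset \<Rightarrow> 'v set \<Rightarrow> 'v uprod set \<Rightarrow> ('v \<Rightarrow> 'a multiset) \<Rightarrow> bool" where
  "M_tree M V E lab \<longleftrightarrow> finite_tree V E \<and> (\<Sum>v\<in>V. lab v) = M
     \<and> (\<forall>v\<in>V. degree E v \<in> {1, 2} \<longrightarrow> lab v \<noteq> {#})"

text \<open>For \<open>e = Upair u v\<close>, the components of \<open>u\<close> and of \<open>v\<close> are the two components left
  after deleting \<open>e\<close> from the tree.\<close>

definition edge_split ::
  "'v set \<Rightarrow> 'v uprod set \<Rightarrow> ('v \<Rightarrow> 'a multiset) \<Rightarrow> 'v uprod \<Rightarrow> 'a multiset uprod" where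
  "edge_split V E lab e = map_uprod (\<lambda>v. \<Sum>w\<in>component V (E - {e}) v. lab w) e"

definition represents ::
  "'v set \<Rightarrow> 'v uprod set \<Rightarrow> ('v \<Rightarrow> 'a multiset) \<Rightarrow> 'a multiset uprod multiset \<Rightarrow> bool" where
  "represents V E lab S \<longleftrightarrow> image_mset (edge_split V E lab) (mset_set E) = S"

text \<open>Trees being finite, it is no restriction to take their vertices from \<^typ>\<open>nat\<close>.\<close>

definition compatible :: "'a multiset \<Rightarrow> 'a multiset uprod multiset \<Rightarrow> bool" where
  "compatible M S \<longleftrightarrow>
     (\<exists>(V :: nat set) E lab. M_tree M V E lab \<and> represents V E lab S)"

end

theory Submission
  imports Defs "HOL-Library.Disjoint_Sets"
begin

text \<open>Let \<open>Q\<close> be the set of small sides of the splits. In a tree, the vertex sets belonging to two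
  small sides are disjoint or nested, so the triples are disjoint, and so are the pairs, each
  pair lying inside a triple or away from all of them. Conversely, such a packing of \<open>Q\<close> into \<open>M\<close>
  yields a tree of depth two. So compatibility means: after an injective assignment of some pairs
  to triples containing them, the remaining pairs and the triples sum up to a submultiset of \<open>M\<close>.

  Let \<open>Q\<close> be minimal without a packing. If \<open>Q\<close> consists of triples only, some \<open>x\<close> is overloaded
  and \<open>Q\<close> has at most \<open>M(x) + 1\<close> members. Otherwise fix a pair \<open>s\<close> and a packing of \<open>Q - {s}\<close>, with
  \<open>d\<close> pairs placed inside triples. No triple contains exactly one pair, as that pair could always
  be placed inside it; let \<open>T0\<close> and \<open>T2\<close> be the sets of triples with none and with at least two, and
  \<open>P\<close> the set of pairs. By minimality \<open>Q\<close> is connected, and since the pairs span the triples of \<open>T2\<close>,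
  its support \<open>Y\<close> has at most \<open>1 + |P| + 2|T0|\<close> elements. The packing uses
  \<open>3|T0| + 3|T2| + 2(|P| - 1 - d)\<close> elements of \<open>M\<close>, all in \<open>Y\<close>, hence at most \<open>\<Delta>(M) + |Y|\<close>. As \<open>d \<le> |T2|\<close>,
  this gives \<open>|Q| \<le> \<Delta>(M) + 3\<close>.\<close>

subsection \<open>Removing an edge of a tree\<close>

lemma adjacency_iff [simp]: "(u, v) \<in> adjacency E \<longleftrightarrow> Upair u v \<in> E"
  by (simp add: adjacency_def)

lemma Upair_commute: "Upair u v = Upair v u"
  by simp

lemma graph_edge_vertices:
  assumes "graph V E" "Upair u v \<in> E"
  shows "u \<noteq> v" "u \<in> V" "v \<in> V"
  using assms by (fastforce simp: graph_def)+

lemma adjacency_rtrancl_sym: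
  assumes "(u, v) \<in> (adjacency E)\<^sup>*"
  shows "(v, u) \<in> (adjacency E)\<^sup>*"
proof -
  have "sym (adjacency E)"
    by (auto intro!: symI simp: Upair_commute)
  then show ?thesis
    using assms by (meson sym_rtrancl symD)
qed

text \<open>Walks are shortened from the front: if the prepended vertex already occurs, the path is
  cut back to the suffix starting there.\<close>

lemma rtrancl_adjacency_distinct_path:
  assumes "(u, v) \<in> (adjacency E)\<^sup>*"
  shows "\<exists>p. p \<noteq> [] \<and> hd p = u \<and> last p = v \<and> distinct p
    \<and> successively (\<lambda>a b. Upair a b \<in> E) p"
  using assms
proof (induction rule: converse_rtrancl_induct)
  case base
  show ?case by (rule exI[of _ "[v]"]) simp
next
  case (step u w)
  then obtain p where p: "p \<noteq> []" "hd p = w" "last p = v" "distinct p"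
    "successively (\<lambda>a b. Upair a b \<in> E) p" by blast
  show ?case
  proof (cases "u \<in> set p")
    case True
    then obtain xs ys where "p = xs @ u # ys" by (meson split_list)
    then show ?thesis
      using p by (intro exI[of _ "u # ys"]) (auto simp: successively_append_iff)
  next
    case False
    then show ?thesis
      using p step(1) by (intro exI[of _ "u # p"]) (auto simp: successively_Cons)
  qed
qed

text \<open>A path from \<open>u\<close> to \<open>v\<close> avoiding the edge between them would be
  closed by that edge to a cycle.\<close>

lemma finite_tree_edge_separates:
  assumes "finite_tree V E" "Upair u v \<in> E"
  shows "(u, v) \<notin> (adjacency (E - {Upair u v}))\<^sup>*"
proof
  let ?F = "E - {Upair u v}"
  assume "(u, v) \<in> (adjacency ?F)\<^sup>*"
  then obtain p where p: "p \<noteq> []" "hd p = u" "last p = v" "distinct p"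
    "successively (\<lambda>a b. Upair a b \<in> ?F) p"
    using rtrancl_adjacency_distinct_path by metis
  have "u \<noteq> v" using assms by (auto simp: finite_tree_def graph_def)
  have "length p \<ge> 3"
  proof (rule ccontr)
    assume "\<not> length p \<ge> 3"
    then consider a where "p = [a]" | a b where "p = [a, b]"
      using p(1) by (cases p rule: remdups_adj.cases) (auto simp: Suc_le_eq)
    then show False using p \<open>u \<noteq> v\<close> by cases auto
  qed
  moreover have "successively (\<lambda>a b. Upair a b \<in> E) p"
    using p(5) by (rule successively_mono) auto
  moreover have "Upair (last p) (hd p) \<in> E"
    using assms(2) p by (metis Upair_commute)
  ultimately have "is_cycle E p" using p(4) by (simp add: is_cycle_def)
  then show False using assms(1) by (auto simp: finite_tree_def)
qed

text \<open>On a walk of the tree from \<open>u\<close>, each passage over the deleted edge ends in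
  \<open>u\<close> or \<open>v\<close>, from where the walk restarts inside
  \<open>F\<close>.\<close>

lemma finite_tree_components:
  assumes "finite_tree V E" "Upair u v \<in> E"
  defines "F \<equiv> E - {Upair u v}"
  shows "component V F u \<inter> component V F v = {}" "component V F u \<union> component V F v = V"
proof -
  show "component V F u \<inter> component V F v = {}"
  proof (rule ccontr)
    assume "\<not> ?thesis"
    then obtain w where "(u, w) \<in> (adjacency F)\<^sup>*" "(v, w) \<in> (adjacency F)\<^sup>*"
      by (auto simp: component_def)
    then have "(u, v) \<in> (adjacency F)\<^sup>*"
      using adjacency_rtrancl_sym rtrancl_trans by metis
    then show False using finite_tree_edge_separates assms by metis
  qed
  have "u \<in> V" "v \<in> V" using assms by (auto simp: finite_tree_def graph_def)
  have "(u, w) \<in> (adjacency F)\<^sup>* \<or> (v, w) \<in> (adjacency F)\<^sup>*" if "w \<in> V" for w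
  proof -
    have "(u, w) \<in> (adjacency E)\<^sup>*"
      using assms \<open>u \<in> V\<close> that by (simp add: finite_tree_def connected_graph_def)
    then show ?thesis
    proof (induction rule: rtrancl_induct)
      case (step y z)
      show ?case
      proof (cases "Upair y z = Upair u v")
        case True
        then show ?thesis by (auto)
      next
        case False
        then have "(y, z) \<in> adjacency F" using step(2) by (simp add: F_def)
        then show ?thesis using step(3) by (meson rtrancl.rtrancl_into_rtrancl)
      qed
    qed simp
  qed
  then show "component V F u \<union> component V F v = V"
    by (auto simp: component_def)
qed

section \<open>Cross-free vertex sets\<close>

definition cross_free :: "'v set \<Rightarrow> 'v set \<Rightarrow> 'v set \<Rightarrow> bool" where
  "cross_free V C D \<longleftrightarrow> C \<inter> D = {} \<or> C \<subseteq> D \<or> D \<subseteq> C \<or> C \<union> D = V"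

text \<open>For subsets of \<open>V\<close>, \<open>cross_free\<close> says that two bipartitions
  have an empty intersection among the four of their sides. Taking a complement only permutes these
  four cases.\<close>

lemma cross_free_complement:
  assumes "cross_free V C D" "C \<inter> C' = {}" "C \<union> C' = V" "D \<inter> D' = {}" "D \<union> D' = V"
  shows "cross_free V C' D" "cross_free V C D'" "cross_free V C' D'"
  using assms unfolding cross_free_def by blast+

text \<open>One side of the first edge misses \<open>x\<close>. It then misses \<open>y\<close> too,
  so it stays connected after deletion of the second edge and lies within one side of that
  edge.\<close>

lemma finite_tree_cross_free:
  assumes tree: "finite_tree V E" and e: "Upair u v \<in> E" and f: "Upair x y \<in> E"
    and ne: "Upair u v \<noteq> Upair x y"
  shows "cross_free V (component V (E - {Upair u v}) u) (component V (E - {Upair x y}) x)"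
proof -
  \<comment> \<open>\<open>a\<close> and \<open>b\<close> name the ends of the first edge in either
    order, \<open>a\<close> being the end whose side misses \<open>x\<close>.\<close>
  have main: "cross_free V (component V (E - {Upair a b}) a) (component V (E - {Upair x y}) x)"
    if a: "Upair a b = Upair u v" and x: "x \<notin> component V (E - {Upair a b}) a" for a b
  proof -
    let ?D = "component V (E - {Upair a b}) a" and ?F = "E - {Upair x y}"
    have "{x, y} \<subseteq> V" "a \<in> V"
      using graph_edge_vertices[of V E] tree f e a unfolding finite_tree_def by auto
    have "y \<notin> ?D"
    proof
      assume "y \<in> ?D"
      then have "(a, y) \<in> (adjacency (E - {Upair a b}))\<^sup>*" by (simp add: component_def)
      moreover have "(y, x) \<in> adjacency (E - {Upair a b})"
        unfolding adjacency_iff a using f ne by (metis DiffI Upair_commute singletonD)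
      ultimately have "(a, x) \<in> (adjacency (E - {Upair a b}))\<^sup>*" by (rule rtrancl_into_rtrancl)
      then show False using x \<open>{x, y} \<subseteq> V\<close> by (simp add: component_def)
    qed
    have "(a, w) \<in> (adjacency ?F)\<^sup>*" if "w \<in> ?D" for w
    proof -
      have "(a, w) \<in> (adjacency (E - {Upair a b}))\<^sup>*" using that by (simp add: component_def)
      then show ?thesis
      proof (induction rule: rtrancl_induct)
        case (step w z)
        have "w \<in> V" using step(2) tree by (auto simp: finite_tree_def graph_def)
        then have "w \<in> ?D" using step(1) by (simp add: component_def)
        then have "Upair w z \<noteq> Upair x y"
          using x \<open>y \<notin> ?D\<close> by (auto)
        then have "(w, z) \<in> adjacency ?F" using step(2) by simp
        with step.IH show ?case by (rule rtrancl_into_rtrancl)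
      qed simp
    qed
    then have sub: "?D \<subseteq> component V ?F a" by (auto simp: component_def)
    have "a \<in> component V ?F x \<union> component V ?F y"
      using finite_tree_components(2)[OF tree f] \<open>a \<in> V\<close> by simp
    then have "?D \<subseteq> component V ?F x \<or> ?D \<subseteq> component V ?F y"
      using sub by (auto simp: component_def intro: rtrancl_trans)
    then show ?thesis
      using finite_tree_components[OF tree f] unfolding cross_free_def by blast
  qed
  show ?thesis
  proof (cases "x \<in> component V (E - {Upair u v}) u")
    case False
    then show ?thesis using main by blast
  next
    \<comment> \<open>Now the side of \<open>v\<close> misses \<open>x\<close>; the claim for it is
      carried over to its complement, the side of \<open>u\<close>.\<close>
    case True
    then have "x \<notin> component V (E - {Upair v u}) v"
      using finite_tree_components(1)[OF tree e] by (auto simp: Upair_commute)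
    then have "cross_free V (component V (E - {Upair v u}) v) (component V (E - {Upair x y}) x)"
      using main Upair_commute by metis
    then have "cross_free V (component V (E - {Upair u v}) v) (component V (E - {Upair x y}) x)"
      by (simp add: Upair_commute)
    then show ?thesis
      by (rule cross_free_complement(1))
        (use finite_tree_components[OF tree e] finite_tree_components[OF tree f] in auto)
  qed
qed

subsection \<open>Attaching a leaf\<close>

lemma is_cycle_nth:
  assumes "is_cycle E p" "i < length p"
  shows "Upair (p ! i) (p ! (Suc i mod length p)) \<in> E"
proof (cases "Suc i < length p")
  case True
  then show ?thesis using assms by (simp add: is_cycle_def successively_conv_nth)
next
  case False
  then have "Suc i = length p" using assms by simp
  moreover have "p \<noteq> []" using assms(2) by auto
  ultimately have "p ! i = last p" "p ! (Suc i mod length p) = hd p"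
    by (simp_all add: last_conv_nth hd_conv_nth flip: \<open>Suc i = length p\<close>)
  then show ?thesis using assms by (simp add: is_cycle_def)
qed

text \<open>The cyclic predecessor \<open>j\<close> and successor \<open>k\<close> differ because a
  cycle has at least three vertices.\<close>

lemma is_cycle_two_neighbours:
  assumes "is_cycle E p" "u \<in> set p"
  shows "\<exists>v w. v \<noteq> w \<and> Upair u v \<in> E \<and> Upair u w \<in> E"
proof -
  let ?n = "length p"
  obtain i where i: "i < ?n" "p ! i = u" using assms(2) by (meson in_set_conv_nth)
  have n: "?n \<ge> 3" "distinct p" using assms by (auto simp: is_cycle_def)
  define j where "j = (if i = 0 then ?n - 1 else i - 1)"
  have j: "j < ?n" "Suc j mod ?n = i" using i n by (auto simp: j_def)
  define k where "k = Suc i mod ?n"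
  have "k < ?n" unfolding k_def using n(1) by (intro mod_less_divisor) linarith
  have "k = (if Suc i = ?n then 0 else Suc i)" using i(1) by (simp add: k_def)
  then have "j \<noteq> k" using i(1) n(1) by (auto simp: j_def)
  then have "p ! j \<noteq> p ! k" using \<open>k < ?n\<close> j n by (simp add: nth_eq_iff_index_eq)
  moreover have "Upair u (p ! k) \<in> E" using is_cycle_nth[OF assms(1) i(1)] i by (simp add: k_def)
  moreover have "Upair u (p ! j) \<in> E"
    using is_cycle_nth[OF assms(1) j(1)] i j by (simp add: Upair_commute)
  ultimately show ?thesis by blast
qed

text \<open>\<open>F\<close> stands for \<open>E\<close> or for \<open>E\<close> without one edge.
  For computing splits, the first equation serves the deletion of an old edge, the other two that of
  the new one.\<close>

lemma component_attach_leaf: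
  assumes gr: "graph V E" and v: "v \<in> V" and u: "u \<notin> V" and w: "w \<in> V" and F: "F \<subseteq> E"
  shows "component (insert u V) (insert (Upair u v) F) w
    = component V F w \<union> (if v \<in> component V F w then {u} else {})"
    and "component (insert u V) F u = {u}"
    and "component (insert u V) F w = component V F w"
proof -
  have grF: "a \<in> V" "b \<in> V" if "Upair a b \<in> F" for a b
    using graph_edge_vertices[OF gr, of a b] that F by auto
  let ?F = "insert (Upair u v) F"
  \<comment> \<open>A walk enters and leaves \<open>u\<close> only through \<open>v\<close>; the
    second conjunct remembers that \<open>v\<close> was reached, so that the excursion can be cut
    out.\<close>
  have *: "(z \<in> V \<longrightarrow> (w, z) \<in> (adjacency F)\<^sup>*) \<and> (z = u \<longrightarrow> (w, v) \<in> (adjacency F)\<^sup>*)"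
    if "(w, z) \<in> (adjacency ?F)\<^sup>*" for z
    using that
  proof (induction rule: rtrancl_induct)
    case base
    then show ?case using w u by auto
  next
    case (step y z)
    show ?case
    proof (cases "Upair y z \<in> F")
      case True
      then have "(w, z) \<in> (adjacency F)\<^sup>*" "z \<in> V"
        using step.IH grF[OF True] by (auto intro: rtrancl_into_rtrancl)
      then show ?thesis using u by auto
    next
      case False
      then have "y = u \<and> z = v \<or> y = v \<and> z = u"
        using step(2) by (auto)
      then show ?thesis using step.IH u v by auto
    qed
  qed
  have mono: "(adjacency F)\<^sup>* \<subseteq> (adjacency ?F)\<^sup>*"
    by (rule rtrancl_mono) auto
  have "(w, u) \<in> (adjacency ?F)\<^sup>*" if "(w, v) \<in> (adjacency F)\<^sup>*"
    using that mono by (auto simp: Upair_commute intro: rtrancl_into_rtrancl[of w v])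
  then show "component (insert u V) ?F w = component V F w \<union> (if v \<in> component V F w then {u} else {})"
    using * mono u v by (auto simp: component_def)
  have "z = u" if "(u, z) \<in> (adjacency F)\<^sup>*" for z
    using that by (rule converse_rtranclE) (use grF u in auto)
  then show "component (insert u V) F u = {u}" by (auto simp: component_def)
  have "(w, u) \<notin> (adjacency F)\<^sup>*"
  proof
    assume "(w, u) \<in> (adjacency F)\<^sup>*"
    then show False by (rule rtranclE) (use grF u w in auto)
  qed
  then show "component (insert u V) F w = component V F w" by (auto simp: component_def)
qed

text \<open>A cycle through \<open>u\<close> would need two distinct neighbours of \<open>u\<close>,
  but \<open>v\<close> is the only one; a cycle avoiding \<open>u\<close> lies in
  \<open>E\<close>.\<close>

lemma finite_tree_attach_leaf:
  assumes tree: "finite_tree V E" and v: "v \<in> V" and u: "u \<notin> V"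
  shows "finite_tree (insert u V) (insert (Upair u v) E)"
proof -
  let ?E = "insert (Upair u v) E"
  have gr: "graph V E" using tree by (simp add: finite_tree_def)
  have not_u: "u \<notin> set_uprod e" if "e \<in> E" for e using gr u that by (auto simp: graph_def)
  have "graph (insert u V) ?E" using gr u v by (auto simp: graph_def)
  moreover have "connected_graph (insert u V) ?E"
  proof -
    have "(v, z) \<in> (adjacency ?E)\<^sup>*" if z: "z \<in> insert u V" for z
    proof -
      have "component V E v = V"
        using tree v by (auto simp: finite_tree_def connected_graph_def component_def)
      then have "component (insert u V) ?E v = insert u V"
        using component_attach_leaf(1)[OF gr v u v order_refl] v by auto
      then show ?thesis using z by (auto simp: component_def)
    qed
    then show ?thesis
      unfolding connected_graph_def by (blast intro: adjacency_rtrancl_sym rtrancl_trans)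
  qed
  moreover have "\<not> is_cycle ?E p" for p
  proof
    assume cyc: "is_cycle ?E p"
    show False
    proof (cases "u \<in> set p")
      case True
      then obtain a b where "a \<noteq> b" "Upair u a \<in> ?E" "Upair u b \<in> ?E"
        using is_cycle_two_neighbours[OF cyc] by blast
      then have "a = v" "b = v" using not_u[of "Upair u a"] not_u[of "Upair u b"] by (auto)
      then show False using \<open>a \<noteq> b\<close> by simp
    next
      case False
      have in_E: "Upair a b \<in> E" if "Upair a b \<in> ?E" "a \<in> set p" "b \<in> set p" for a b
        using that False by (auto)
      have "successively (\<lambda>a b. Upair a b \<in> E) p"
        using cyc by (auto simp only: is_cycle_def intro: in_E elim!: successively_mono)
      moreover have "Upair (last p) (hd p) \<in> E"
        using cyc unfolding is_cycle_def by (intro in_E last_in_set hd_in_set) auto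
      ultimately have "is_cycle E p" using cyc by (simp add: is_cycle_def)
      then show False using tree by (auto simp: finite_tree_def)
    qed
  qed
  ultimately show ?thesis using tree by (simp add: finite_tree_def)
qed

lemma finite_tree_finite_edges:
  assumes "finite_tree V E"
  shows "finite E"
proof -
  have "E \<subseteq> (\<lambda>(a, b). Upair a b) ` (V \<times> V)"
  proof
    fix e assume "e \<in> E"
    moreover obtain a b where "e = Upair a b" by (cases e)
    ultimately show "e \<in> (\<lambda>(a, b). Upair a b) ` (V \<times> V)"
      using graph_edge_vertices[of V E] assms by (auto simp: finite_tree_def)
  qed
  then show ?thesis using assms by (auto simp: finite_tree_def intro: finite_subset)
qed

lemma degree_attach_leaf:
  assumes "finite_tree V E" "v \<in> V" "u \<notin> V" "w \<in> V"
  shows "degree (insert (Upair u v) E) w = degree E w + (if w = v then 1 else 0)"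
proof -
  have u: "Upair u v \<notin> E" using assms by (auto simp: finite_tree_def graph_def)
  have "finite E" using finite_tree_finite_edges assms(1) .
  moreover have "{e \<in> insert (Upair u v) E. w \<in> set_uprod e}
    = {e \<in> E. w \<in> set_uprod e} \<union> (if w = v then {Upair u v} else {})"
    using assms by auto
  ultimately show ?thesis using u by (auto simp: degree_def)
qed

section \<open>Labelled trees grown leaf by leaf, with the nonempty-label condition deferred\<close>

definition labelled_tree ::
  "'a multiset \<Rightarrow> 'v set \<Rightarrow> 'v uprod set \<Rightarrow> ('v \<Rightarrow> 'a multiset) \<Rightarrow> 'a multiset uprod multiset \<Rightarrow> bool" where
  "labelled_tree M V E lab S \<longleftrightarrow> finite_tree V E \<and> (\<Sum>v\<in>V. lab v) = M \<and> represents V E lab S"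

abbreviation split_of :: "'a multiset \<Rightarrow> 'a multiset \<Rightarrow> 'a multiset uprod" where
  "split_of M A \<equiv> Upair A (M - A)"

text \<open>Moving \<open>A\<close> from \<open>v\<close> to a new leaf at \<open>v\<close> keeps
  every old split, as both vertices lie on the same side of every old edge; the new edge cuts off
  \<open>A\<close>.\<close>

lemma labelled_tree_attach_leaf:
  assumes T: "labelled_tree M V E lab S" and v: "v \<in> V" and u: "u \<notin> V" and A: "A \<subseteq># lab v"
  shows "labelled_tree M (insert u V) (insert (Upair u v) E)
    (lab(v := lab v - A, u := A)) (add_mset (split_of M A) S)"
proof -
  let ?V = "insert u V" and ?E = "insert (Upair u v) E" and ?lab = "lab(v := lab v - A, u := A)"
  have tree: "finite_tree V E" and sumM: "(\<Sum>w\<in>V. lab w) = M"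
    and rep: "image_mset (edge_split V E lab) (mset_set E) = S"
    using T by (auto simp: labelled_tree_def represents_def)
  have gr: "graph V E" and fin: "finite V" using tree by (auto simp: finite_tree_def)
  have new: "Upair u v \<notin> E" using graph_edge_vertices[OF gr] u by blast
  have sum_eq: "(\<Sum>w\<in>C \<union> (if v \<in> C then {u} else {}). ?lab w) = (\<Sum>w\<in>C. lab w)"
    if C: "C \<subseteq> V" for C
  proof -
    have "finite C" "u \<notin> C" using C fin u finite_subset by auto
    show ?thesis
    proof (cases "v \<in> C")
      case True
      have "(\<Sum>w\<in>C - {v}. ?lab w) = (\<Sum>w\<in>C - {v}. lab w)"
        using \<open>u \<notin> C\<close> by (intro sum.cong) auto
      moreover have "u \<noteq> v" using u v by blast
      ultimately have "(\<Sum>w\<in>C. ?lab w) = lab v - A + (\<Sum>w\<in>C - {v}. lab w)"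
        using True \<open>finite C\<close> by (subst sum.remove[of C v]) auto
      moreover have "A + (lab v - A) = lab v" using A by simp
      ultimately have "A + (\<Sum>w\<in>C. ?lab w) = (\<Sum>w\<in>C. lab w)"
        using True \<open>finite C\<close> by (metis add.assoc sum.remove)
      then show ?thesis using True \<open>finite C\<close> \<open>u \<notin> C\<close> by simp
    next
      case False
      then show ?thesis using \<open>u \<notin> C\<close> by (auto intro: sum.cong)
    qed
  qed
  have sumM': "(\<Sum>w\<in>?V. ?lab w) = M"
    using sum_eq[of V] v sumM by (simp add: insert_is_Un[symmetric])
  have old: "edge_split ?V ?E ?lab e = edge_split V E lab e" if e: "e \<in> E" for e
  proof -
    obtain a b where ab: "e = Upair a b" by (cases e)
    have V: "a \<in> V" "b \<in> V" using graph_edge_vertices[OF gr] e ab by auto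
    have E: "?E - {e} = insert (Upair u v) (E - {e})" using e new by auto
    have "(\<Sum>w\<in>component ?V (?E - {e}) z. ?lab w) = (\<Sum>w\<in>component V (E - {e}) z. lab w)"
      if "z \<in> V" for z
      unfolding E component_attach_leaf(1)[OF gr v u that Diff_subset]
      by (rule sum_eq) (auto simp: component_def)
    then show ?thesis using V by (simp add: edge_split_def ab)
  qed
  have "edge_split ?V ?E ?lab (Upair u v) = split_of M A"
  proof -
    have E: "?E - {Upair u v} = E" using new by auto
    have "component V E v = V"
      using tree v by (auto simp: finite_tree_def connected_graph_def component_def)
    then have "component ?V E v = V" "component ?V E u = {u}"
      using component_attach_leaf(2,3)[OF gr v u v order_refl] by auto
    moreover have "A + (\<Sum>w\<in>V. ?lab w) = M" using sumM' u fin by simp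
    then have "(\<Sum>w\<in>V. ?lab w) = M - A" by auto
    ultimately show ?thesis by (simp add: edge_split_def E)
  qed
  moreover have "image_mset (edge_split ?V ?E ?lab) (mset_set E) = S"
    using old finite_tree_finite_edges[OF tree] unfolding rep[symmetric] by (intro image_mset_cong) simp
  ultimately have "represents ?V ?E ?lab (add_mset (split_of M A) S)"
    using new finite_tree_finite_edges[OF tree]
    by (simp only: represents_def mset_set.insert image_mset_add_mset not_False_eq_True)
  then show ?thesis
    using finite_tree_attach_leaf[OF tree v u] sumM' by (simp add: labelled_tree_def)
qed

lemma labelled_tree_star:
  assumes "finite \<B>" "\<Sum>\<B> \<subseteq># M" "{#} \<notin> \<B>"
    and g: "\<forall>B\<in>\<H>. g B \<noteq> {#} \<and> g B \<subset># B"
  shows "\<exists>V E lab r. labelled_tree M V E lab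
      (image_mset (split_of M) (mset_set \<B>) + image_mset (split_of M) (image_mset g (mset_set (\<B> \<inter> \<H>))))
    \<and> (r :: nat) \<in> V \<and> lab r = M - \<Sum>\<B> \<and> degree E r = card \<B> \<and> (\<forall>v\<in>V - {r}. lab v \<noteq> {#})"
  using assms(1-3)
proof (induction \<B> rule: finite_induct)
  case empty
  have "finite_tree {0 :: nat} {}"
    by (auto simp: finite_tree_def graph_def connected_graph_def is_cycle_def Suc_le_length_iff
        numeral_3_eq_3)
  then have "labelled_tree M {0 :: nat} {} (\<lambda>_. M) {#}"
    by (simp add: labelled_tree_def represents_def)
  then show ?case
    by (intro exI[of _ "{0}"] exI[of _ "{}"] exI[of _ "\<lambda>_. M"] exI[of _ 0]) (simp add: degree_def)
next
  case (insert B \<B>)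
  have sums: "B + \<Sum>\<B> \<subseteq># M" "B \<noteq> {#}" using insert by auto
  then have "\<Sum>\<B> \<subseteq># M" using mset_subset_eq_add_right subset_mset.order_trans by blast
  then obtain V E lab r where T: "labelled_tree M V E lab
      (image_mset (split_of M) (mset_set \<B>) + image_mset (split_of M) (image_mset g (mset_set (\<B> \<inter> \<H>))))"
    (is "labelled_tree _ _ _ _ ?S") and r: "(r :: nat) \<in> V" "lab r = M - \<Sum>\<B>" "degree E r = card \<B>"
    and lab: "\<forall>v\<in>V - {r}. lab v \<noteq> {#}"
    using insert by auto
  have tree: "finite_tree V E" using T by (simp add: labelled_tree_def)
  then have fin: "finite V" by (simp add: finite_tree_def)
  obtain u where u: "u \<notin> V" using ex_new_if_finite[OF infinite_UNIV_nat fin] by blast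
  have B: "B \<subseteq># lab r" using sums(1) r(2) by (auto simp: mset_subset_eq_exists_conv add_ac)
  define V1 E1 lab1 where "V1 = insert u V" and "E1 = insert (Upair u r) E"
    and "lab1 = lab(r := lab r - B, u := B)"
  note defs1 = V1_def E1_def lab1_def
  have T1: "labelled_tree M V1 E1 lab1 (add_mset (split_of M B) ?S)"
    unfolding defs1 by (rule labelled_tree_attach_leaf[OF T r(1) u B])
  have deg1: "degree E1 r = card (insert B \<B>)"
    using degree_attach_leaf[OF tree r(1) u r(1)] insert.hyps r by (simp add: E1_def)
  have "u \<noteq> r" using u r by blast
  have lab1: "lab1 r = M - \<Sum>(insert B \<B>)" "lab1 u = B" "\<forall>v\<in>V1 - {r}. lab1 v \<noteq> {#}"
    using insert.hyps r lab \<open>u \<noteq> r\<close> sums(2) by (auto simp: lab1_def V1_def add.commute)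
  have V1: "r \<in> V1" "u \<in> V1" "finite V1" using r fin by (auto simp: V1_def)
  show ?case
  proof (cases "B \<in> \<H>")
    case False
    then have "labelled_tree M V1 E1 lab1 (image_mset (split_of M) (mset_set (insert B \<B>))
      + image_mset (split_of M) (image_mset g (mset_set (insert B \<B> \<inter> \<H>))))"
      using T1 insert.hyps by simp
    then show ?thesis using V1 lab1 deg1 by blast
  next
    case True
    then have gB: "g B \<noteq> {#}" "g B \<subset># B" using g by auto
    obtain w where w: "w \<notin> V1" using ex_new_if_finite[OF infinite_UNIV_nat V1(3)] by blast
    define V2 E2 lab2 where "V2 = insert w V1" and "E2 = insert (Upair w u) E1"
      and "lab2 = lab1(u := lab1 u - g B, w := g B)"
    note defs2 = V2_def E2_def lab2_def
    have "w \<noteq> r" using w V1 by blast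
    have "g B \<subseteq># lab1 u" using gB lab1 by (simp add: subset_mset.less_imp_le)
    then have "labelled_tree M V2 E2 lab2 (add_mset (split_of M (g B)) (add_mset (split_of M B) ?S))"
      unfolding defs2 using T1 V1(2) w by (rule labelled_tree_attach_leaf[rotated -1])
    then have "labelled_tree M V2 E2 lab2 (image_mset (split_of M) (mset_set (insert B \<B>))
      + image_mset (split_of M) (image_mset g (mset_set (insert B \<B> \<inter> \<H>))))"
      using True insert.hyps by (simp add: add_mset_commute)
    moreover have "finite_tree V1 E1" using T1 by (simp add: labelled_tree_def)
    then have "degree E2 r = card (insert B \<B>)"
      using degree_attach_leaf[OF _ V1(2) w V1(1)] deg1 \<open>u \<noteq> r\<close> by (simp add: E2_def)
    \<comment> \<open>\<open>u\<close> gets degree two by the second leaf, so its label must remain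
      nonempty.\<close>
    moreover have "B - g B \<noteq> {#}"
      using gB by (metis Diff_eq_empty_iff_mset subset_mset.less_le_not_le)
    then have "lab2 r = M - \<Sum>(insert B \<B>)" "\<forall>v\<in>V2 - {r}. lab2 v \<noteq> {#}"
      using lab1 gB \<open>u \<noteq> r\<close> \<open>w \<noteq> r\<close> by (auto simp: lab2_def V2_def)
    moreover have "r \<in> V2" using V1 by (simp add: V2_def)
    ultimately show ?thesis by blast
  qed
qed

subsection \<open>Packings\<close>

text \<open>When both sides of a split have the same size, either may be chosen; injectivity keeps
  \<open>Q\<close> from containing two different sides of one split.\<close>

definition small_sides :: "'a multiset \<Rightarrow> 'a multiset set \<Rightarrow> bool" where
  "small_sides M Q \<longleftrightarrow> finite Q \<and> inj_on (split_of M) Q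
    \<and> (\<forall>A\<in>Q. A \<subseteq># M \<and> size A \<in> {2, 3} \<and> 2 * size A \<le> size M)"

text \<open>The multisets of \<open>D\<close> are the pairs to be placed inside a triple, \<open>f\<close> choosing the triple;
  everything else has to fit into \<open>M\<close> disjointly.\<close>

definition packable :: "'a multiset \<Rightarrow> 'a multiset set \<Rightarrow> bool" where
  "packable M Q \<longleftrightarrow> (\<exists>D f. D \<subseteq> {A \<in> Q. size A = 2} \<and> inj_on f D
    \<and> (\<forall>p\<in>D. f p \<in> Q \<and> size (f p) = 3 \<and> p \<subseteq># f p) \<and> \<Sum>(Q - D) \<subseteq># M)"

lemma small_sides_subset: "small_sides M Q \<Longrightarrow> R \<subseteq> Q \<Longrightarrow> small_sides M R"
  by (auto simp: small_sides_def intro: finite_subset inj_on_subset)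

lemma size_sum:
  fixes h :: "'i \<Rightarrow> 'a multiset"
  shows "size (\<Sum>i\<in>I. h i) = (\<Sum>i\<in>I. size (h i))"
  by (induction I rule: infinite_finite_induct) auto

section \<open>From packings to trees\<close>

lemma small_sides_add_neq:
  assumes Q: "small_sides M Q" and AB: "A \<in> Q" "B \<in> Q" "A \<noteq> B"
  shows "A + B \<noteq> M"
proof
  assume "A + B = M"
  then have "split_of M A = split_of M B" by auto
  then show False using Q AB by (auto simp: small_sides_def inj_on_def)
qed

text \<open>The blocks are the members outside \<open>D\<close>, and each triple \<open>f p\<close>
  passes \<open>p\<close> on to its extra leaf. Only the root label remains to be checked.\<close>

lemma packable_imp_compatible:
  assumes Q: "small_sides M Q" and "packable M Q"
  shows "compatible M (image_mset (split_of M) (mset_set Q))"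
proof -
  obtain D f where D: "D \<subseteq> {A \<in> Q. size A = 2}" "inj_on f D"
    "\<forall>p\<in>D. f p \<in> Q \<and> size (f p) = 3 \<and> p \<subseteq># f p" "\<Sum>(Q - D) \<subseteq># M"
    using assms by (auto simp: packable_def)
  have fin: "finite Q" "finite D" using Q D by (auto simp: small_sides_def intro: finite_subset)
  have "{#} \<notin> Q" using Q by (force simp: small_sides_def)
  define g where "g = inv_into D f"
  have "g (f p) = p" if "p \<in> D" for p using D that by (simp add: g_def)
  then have "\<forall>B\<in>f ` D. g B \<noteq> {#} \<and> g B \<subset># B"
    using D \<open>{#} \<notin> Q\<close> by (fastforce simp: subset_mset_def)
  then obtain V E lab r where T: "labelled_tree M V E lab
      (image_mset (split_of M) (mset_set (Q - D)) +
       image_mset (split_of M) (image_mset g (mset_set ((Q - D) \<inter> f ` D))))"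
    and r: "(r :: nat) \<in> V" "lab r = M - \<Sum>(Q - D)" "degree E r = card (Q - D)"
    and lab: "\<forall>v\<in>V - {r}. lab v \<noteq> {#}"
    using labelled_tree_star[of "Q - D" M "f ` D" g] fin D \<open>{#} \<notin> Q\<close> by blast
  have "(Q - D) \<inter> f ` D = f ` D" using D by fastforce
  moreover have "image_mset g (mset_set (f ` D)) = mset_set D"
    using D by (simp add: g_def image_mset_mset_set inj_on_inv_into)
  moreover have "mset_set (Q - D) + mset_set D = mset_set Q"
    using fin D by (subst mset_set_Union[symmetric]) (auto intro: arg_cong[of _ _ mset_set])
  ultimately have "labelled_tree M V E lab (image_mset (split_of M) (mset_set Q))"
    using T by (metis image_mset_union)
  \<comment> \<open>With empty root label, degree 1 would need a member equal to \<open>M\<close>,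
    which is too large; with degree 2 the two blocks would be the two sides of one split.\<close>
  moreover have "lab r \<noteq> {#}" if "card (Q - D) \<in> {1, 2}"
  proof
    assume "lab r = {#}"
    then have M: "\<Sum>(Q - D) = M" using r D(4) by (simp add: Diff_eq_empty_iff_mset)
    have QD: "A \<in> Q" "2 * size A \<le> size M" "A \<noteq> {#}" if "A \<in> Q - D" for A
      using Q that \<open>{#} \<notin> Q\<close> by (auto simp: small_sides_def)
    from that consider "card (Q - D) = 1" | "card (Q - D) = 2" by auto
    then show False
    proof cases
      case 1
      then obtain A where "Q - D = {A}" by (rule card_1_singletonE)
      then show False using M QD[of A] by (auto simp: nonempty_has_size)
    next
      case 2
      then obtain A B where AB: "A \<noteq> B" "Q - D = {A, B}" by (auto simp: card_2_iff)
      then have "A + B = M" using M by simp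
      then show False using AB QD small_sides_add_neq[OF Q] by blast
    qed
  qed
  ultimately show ?thesis
    using r lab unfolding compatible_def M_tree_def labelled_tree_def by (metis Diff_iff singletonD)
qed

subsection \<open>Vertex sets carrying the small sides\<close>

text \<open>What is kept of a tree: for each small side, the vertices that carry it. Without edges,
  restriction to a subfamily is immediate.\<close>

definition realises ::
  "'a multiset \<Rightarrow> 'v set \<Rightarrow> ('v \<Rightarrow> 'a multiset) \<Rightarrow> ('a multiset \<Rightarrow> 'v set) \<Rightarrow> 'a multiset set \<Rightarrow> bool" where
  "realises M V lab C Q \<longleftrightarrow> finite V \<and> (\<Sum>v\<in>V. lab v) = M
    \<and> (\<forall>A\<in>Q. C A \<subseteq> V \<and> (\<Sum>v\<in>C A. lab v) = A)
    \<and> (\<forall>A\<in>Q. \<forall>B\<in>Q. A \<noteq> B \<longrightarrow> cross_free V (C A) (C B))"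

lemma realises_subset: "realises M V lab C Q \<Longrightarrow> R \<subseteq> Q \<Longrightarrow> realises M V lab C R"
  unfolding realises_def by blast

text \<open>Each split comes from an edge, whose ends are ordered so that the component of the first
  carries the chosen small side. Different members give different splits, hence different
  edges.\<close>

lemma compatible_imp_realises:
  assumes Q: "small_sides M Q" and comp: "compatible M (image_mset (split_of M) (mset_set Q))"
  shows "\<exists>(V :: nat set) lab C. realises M V lab C Q"
proof -
  obtain V :: "nat set" and E lab where tree: "finite_tree V E" and M: "(\<Sum>v\<in>V. lab v) = M"
    and rep: "image_mset (edge_split V E lab) (mset_set E) = image_mset (split_of M) (mset_set Q)"
    using comp by (auto simp: compatible_def M_tree_def represents_def)
  have fin: "finite E" "finite Q" using finite_tree_finite_edges[OF tree] Q by (auto simp: small_sides_def)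
  have "\<exists>u v. Upair u v \<in> E \<and> edge_split V E lab (Upair u v) = split_of M A
    \<and> (\<Sum>w\<in>component V (E - {Upair u v}) u. lab w) = A" if "A \<in> Q" for A
  proof -
    have "split_of M A \<in> edge_split V E lab ` E"
      using arg_cong[OF rep, of set_mset] that fin by auto
    then obtain e where e: "e \<in> E" "edge_split V E lab e = split_of M A" by auto
    obtain u v where uv: "e = Upair u v" by (cases e)
    let ?s = "\<lambda>z. \<Sum>w\<in>component V (E - {e}) z. lab w"
    have "Upair (?s u) (?s v) = split_of M A" using e uv by (simp add: edge_split_def)
    then consider "?s u = A" | "?s v = A" by auto
    then show ?thesis
    proof cases
      case 1
      then show ?thesis using e uv by blast
    next
      case 2
      moreover have "e = Upair v u" using uv by simp
      ultimately show ?thesis using e by blast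
    qed
  qed
  then obtain h k where hk: "\<And>A. A \<in> Q \<Longrightarrow> Upair (h A) (k A) \<in> E
    \<and> edge_split V E lab (Upair (h A) (k A)) = split_of M A
    \<and> (\<Sum>w\<in>component V (E - {Upair (h A) (k A)}) (h A). lab w) = A"
    by metis
  have "cross_free V (component V (E - {Upair (h A) (k A)}) (h A))
    (component V (E - {Upair (h B) (k B)}) (h B))" if "A \<in> Q" "B \<in> Q" "A \<noteq> B" for A B
  proof (rule finite_tree_cross_free[OF tree])
    have "split_of M A \<noteq> split_of M B"
      using Q that unfolding small_sides_def inj_on_def by blast
    then show "Upair (h A) (k A) \<noteq> Upair (h B) (k B)" using hk that by metis
  qed (use hk that in auto)
  then have "realises M V lab (\<lambda>A. component V (E - {Upair (h A) (k A)}) (h A)) Q"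
    using tree M hk by (auto simp: realises_def finite_tree_def component_def)
  then show ?thesis by blast
qed

lemma sum_subset_subseteq_mset:
  fixes lab :: "'v \<Rightarrow> 'a multiset"
  assumes "C \<subseteq> D" "finite D"
  shows "(\<Sum>v\<in>C. lab v) \<subseteq># (\<Sum>v\<in>D. lab v)"
  using sum.subset_diff[OF assms, of lab] by simp

text \<open>Two vertex sets covering the tree would have to be complementary, by size; then
  \<open>A + B = M\<close> and \<open>A\<close>, \<open>B\<close> give the same split.\<close>

lemma realises_disjoint_or_nested:
  assumes Q: "small_sides M Q" and real: "realises M V lab C Q" and AB: "A \<in> Q" "B \<in> Q" "A \<noteq> B"
  shows "C A \<inter> C B = {} \<or> C A \<subseteq> C B \<and> A \<subset># B \<or> C B \<subseteq> C A \<and> B \<subset># A"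
proof -
  have V: "finite V" "(\<Sum>v\<in>V. lab v) = M" using real by (auto simp: realises_def)
  have C: "C X \<subseteq> V" "(\<Sum>v\<in>C X. lab v) = X" "finite (C X)" if "X \<in> Q" for X
    using real that by (auto simp: realises_def intro: finite_subset)
  have "M \<noteq> A + B" using small_sides_add_neq[OF Q AB] by simp
  have nested: "X \<subseteq># Y" if "C X \<subseteq> C Y" "X \<in> Q" "Y \<in> Q" for X Y
    using sum_subset_subseteq_mset[OF that(1), of lab] C that by simp
  have "C A \<inter> C B = {}" if "C A \<union> C B = V"
  proof -
    have "A + B = M + (\<Sum>v\<in>C A \<inter> C B. lab v)"
      using sum.union_inter[of "C A" "C B" lab] C AB that V by simp
    moreover have "2 * size A \<le> size M" "2 * size B \<le> size M"
      using Q AB by (auto simp: small_sides_def)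
    then have "size A + size B \<le> size M" by linarith
    ultimately have "(\<Sum>v\<in>C A \<inter> C B. lab v) = {#}"
      by (metis add_le_same_cancel1 le_zero_eq size_eq_0_iff_empty size_union)
    then show ?thesis using \<open>A + B = _\<close> \<open>M \<noteq> A + B\<close> by simp
  qed
  then show ?thesis
    using real AB nested unfolding realises_def cross_free_def subset_mset_def by metis
qed

text \<open>Used with \<open>W\<close> the vertex set of one triple, to bound the pairs inside it,
  and with \<open>W = V\<close>.\<close>

lemma realises_disjoint_sum:
  assumes real: "realises M V lab C Q" and R: "R \<subseteq> Q" "finite R" "disjoint_family_on C R"
    and W: "\<And>A. A \<in> R \<Longrightarrow> C A \<subseteq> W" "W \<subseteq> V"
  shows "\<Sum>R \<subseteq># (\<Sum>v\<in>W. lab v)"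
proof -
  have fin: "finite W" "\<forall>A\<in>R. finite (C A)"
    using real W by (auto simp: realises_def intro: finite_subset)
  have "\<Sum>R = (\<Sum>A\<in>R. \<Sum>v\<in>C A. lab v)"
    using real R by (intro sum.cong) (auto simp: realises_def)
  also have "\<dots> = (\<Sum>v\<in>\<Union>(C ` R). lab v)"
    using R fin by (intro sum.UNION_disjoint[symmetric]) (auto simp: disjoint_family_on_def)
  also have "\<dots> \<subseteq># (\<Sum>v\<in>W. lab v)"
    using W fin by (intro sum_subset_subseteq_mset) auto
  finally show ?thesis .
qed

lemma realises_imp_packable:
  assumes Q: "small_sides M Q" and real: "realises M V lab C Q"
  shows "packable M Q"
proof -
  have size_Q: "size A = 2 \<or> size A = 3" if "A \<in> Q" for A using Q that by (auto simp: small_sides_def)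
  define D where "D = {p \<in> Q. size p = 2 \<and> (\<exists>t\<in>Q. size t = 3 \<and> C p \<subseteq> C t)}"
  then have "\<forall>p\<in>D. \<exists>t. t \<in> Q \<and> size t = 3 \<and> C p \<subseteq> C t" by blast
  from bchoice[OF this] obtain f
    where f: "\<And>p. p \<in> D \<Longrightarrow> f p \<in> Q \<and> size (f p) = 3 \<and> C p \<subseteq> C (f p)"
    by blast
  have fin: "finite Q" using Q by (simp add: small_sides_def)
  have C: "C A \<subseteq> V" "(\<Sum>v\<in>C A. lab v) = A" "finite (C A)" if "A \<in> Q" for A
    using real that by (auto simp: realises_def intro: finite_subset)
  have "p \<subseteq># f p" if "p \<in> D" for p
    using sum_subset_subseteq_mset[of "C p" "C (f p)" lab] f[OF that] C that by (auto simp: D_def)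
  \<comment> \<open>Pairs cannot be properly nested, so two of them inside one triple would be
    disjoint and need four elements.\<close>
  moreover have "inj_on f D"
  proof (rule inj_onI, rule ccontr)
    fix p q assume pq: "p \<in> D" "q \<in> D" "f p = f q" "p \<noteq> q"
    then have "size p = 2" "size q = 2" "p \<in> Q" "q \<in> Q" by (auto simp: D_def)
    then have "C p \<inter> C q = {}"
      using realises_disjoint_or_nested[OF Q real, of p q] pq(4) mset_subset_size[of p q]
        mset_subset_size[of q p] by auto
    then have "\<Sum>{p, q} \<subseteq># (\<Sum>v\<in>C (f p). lab v)"
      using f[of p] f[of q] pq \<open>p \<in> Q\<close> \<open>q \<in> Q\<close> C
      by (intro realises_disjoint_sum[OF real]) (auto simp: disjoint_family_on_def)
    then show False
      using pq(4) f[OF pq(1)] C \<open>size p = 2\<close> \<open>size q = 2\<close> by (auto dest!: size_mset_mono)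
  qed
  moreover have "\<Sum>(Q - D) \<subseteq># M"
  proof -
    \<comment> \<open>Nesting would require a pair inside a triple, and such pairs belong to
      \<open>D\<close>.\<close>
    have "C A \<inter> C B = {}" if "A \<in> Q - D" "B \<in> Q - D" "A \<noteq> B" for A B
      using realises_disjoint_or_nested[OF Q real, of A B] that size_Q[of A] size_Q[of B]
        mset_subset_size[of A B] mset_subset_size[of B A] by (auto simp: D_def)
    then have "\<Sum>(Q - D) \<subseteq># (\<Sum>v\<in>V. lab v)"
      using fin C by (intro realises_disjoint_sum[OF real]) (auto simp: disjoint_family_on_def)
    then show ?thesis using real by (simp add: realises_def)
  qed
  ultimately show ?thesis
    unfolding packable_def using f by (intro exI[of _ D] exI[of _ f]) (auto simp: D_def)
qed

lemma compatible_iff_packable: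
  assumes "small_sides M Q"
  shows "compatible M (image_mset (split_of M) (mset_set Q)) \<longleftrightarrow> packable M Q"
  using assms packable_imp_compatible compatible_imp_realises realises_imp_packable by metis

subsection \<open>Minimal families without a packing\<close>

lemma sum_count_le_Delta:
  assumes "Y \<subseteq> set_mset M"
  shows "(\<Sum>x\<in>Y. count M x) \<le> Delta M + card Y"
proof -
  have "(\<Sum>x\<in>Y. count M x) = (\<Sum>x\<in>Y. (count M x - 1) + 1)"
    using assms by (intro sum.cong) (auto simp: Suc_le_eq)
  also have "\<dots> = (\<Sum>x\<in>Y. count M x - 1) + card Y"
    by (simp only: sum.distrib card_eq_sum)
  also have "(\<Sum>x\<in>Y. count M x - 1) \<le> Delta M"
    unfolding Delta_def using assms by (intro sum_mono2) auto
  finally show ?thesis by simp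
qed

text \<open>The two packings never compete for an element of \<open>M\<close>: on \<open>Y\<close>
  only \<open>Q\<close> counts, off \<open>Y\<close> only \<open>R\<close>.\<close>

lemma packable_Un_disjoint:
  assumes fin: "finite Q" "finite R" and ne: "{#} \<notin> Q" and "packable M Q" "packable M R"
    and Y: "\<forall>A\<in>Q. set_mset A \<subseteq> Y" "\<forall>A\<in>R. set_mset A \<inter> Y = {}"
  shows "packable M (Q \<union> R)"
proof -
  obtain D f where D: "D \<subseteq> {A \<in> Q. size A = 2}" "inj_on f D"
    "\<forall>p\<in>D. f p \<in> Q \<and> size (f p) = 3 \<and> p \<subseteq># f p" "\<Sum>(Q - D) \<subseteq># M"
    using assms(4) by (auto simp: packable_def)
  obtain D' f' where D': "D' \<subseteq> {A \<in> R. size A = 2}" "inj_on f' D'"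
    "\<forall>p\<in>D'. f' p \<in> R \<and> size (f' p) = 3 \<and> p \<subseteq># f' p" "\<Sum>(R - D') \<subseteq># M"
    using assms(5) by (auto simp: packable_def)
  \<comment> \<open>A common member would have its support inside \<open>Y\<close> and disjoint from
    \<open>Y\<close>, so it would be empty.\<close>
  have disj: "Q \<inter> R = {}"
    using ne Y by (metis Int_absorb2 Int_emptyI set_mset_eq_empty_iff)
  define h where "h = (\<lambda>p. if p \<in> D then f p else f' p)"
  have "inj_on h (D \<union> D')"
    using D(1-3) D'(1-3) disj unfolding h_def inj_on_def by (smt (verit) UnE disjoint_iff mem_Collect_eq subset_iff)
  moreover have "\<forall>p\<in>D \<union> D'. h p \<in> Q \<union> R \<and> size (h p) = 3 \<and> p \<subseteq># h p"
    using D(3) D'(3) by (auto simp: h_def)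
  moreover have "\<Sum>((Q \<union> R) - (D \<union> D')) \<subseteq># M"
  proof -
    have "(Q \<union> R) - (D \<union> D') = (Q - D) \<union> (R - D')" using D(1) D'(1) disj by blast
    then have eq: "\<Sum>((Q \<union> R) - (D \<union> D')) = \<Sum>(Q - D) + \<Sum>(R - D')"
      using fin disj by (simp add: sum.union_disjoint Diff_disjoint disjoint_iff)
    show ?thesis
    proof (rule mset_subset_eqI)
      fix x
      have *: "count (\<Sum>(Q - D)) x \<le> count M x" "count (\<Sum>(R - D')) x \<le> count M x"
        using D(4) D'(4) by (auto simp: mset_subset_eq_count)
      show "count (\<Sum>((Q \<union> R) - (D \<union> D'))) x \<le> count M x"
      proof (cases "x \<in> Y")
        case True
        then have "count (\<Sum>(R - D')) x = 0"
          using Y(2) by (force simp: count_sum not_in_iff[symmetric] intro: sum.neutral)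
        then show ?thesis using * eq by simp
      next
        case False
        then have "count (\<Sum>(Q - D)) x = 0"
          using Y(1) by (force simp: count_sum not_in_iff[symmetric] intro: sum.neutral)
        then show ?thesis using * eq by simp
      qed
    qed
  qed
  moreover have "D \<union> D' \<subseteq> {A \<in> Q \<union> R. size A = 2}" using D(1) D'(1) by auto
  ultimately show ?thesis unfolding packable_def by blast
qed

text \<open>A packing of the rest places no pair inside \<open>t\<close>, as only \<open>p\<close>
  fits there; so \<open>t\<close> is free for \<open>p\<close>.\<close>

lemma packable_insert_absorbed:
  assumes pack: "packable M (Q - {p})" and p: "p \<in> Q" "size p = 2" and t: "t \<in> Q" "size t = 3" "p \<subseteq># t"
    and uniq: "\<And>q. q \<in> Q \<Longrightarrow> size q = 2 \<Longrightarrow> q \<subseteq># t \<Longrightarrow> q = p"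
  shows "packable M Q"
proof -
  obtain D f where D: "D \<subseteq> {A \<in> Q - {p}. size A = 2}" "inj_on f D"
    "\<forall>q\<in>D. f q \<in> Q - {p} \<and> size (f q) = 3 \<and> q \<subseteq># f q" "\<Sum>(Q - {p} - D) \<subseteq># M"
    using pack by (auto simp: packable_def)
  have "f q \<noteq> t" if "q \<in> D" for q using D uniq[of q] that by auto
  moreover have "p \<notin> D" using D(1) by blast
  ultimately have "inj_on (f(p := t)) (insert p D)" using D(2) by (auto simp: inj_on_def)
  moreover have "Q - {p} - D = Q - insert p D" by blast
  ultimately show ?thesis
    unfolding packable_def using D p t \<open>p \<notin> D\<close>
    by (intro exI[of _ "insert p D"] exI[of _ "f(p := t)"]) auto
qed

text \<open>The union \<open>p \<union># q\<close> is strictly larger than \<open>p\<close>, hence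
  all of \<open>t\<close>; disjoint supports would give it size 4.\<close>

lemma two_pairs_cover_triple:
  assumes "size p = 2" "size q = 2" "size t = 3" "p \<subseteq># t" "q \<subseteq># t" "p \<noteq> q"
  shows "set_mset p \<inter> set_mset q \<noteq> {}" "set_mset t = set_mset p \<union> set_mset q"
proof -
  have sub: "p \<union># q \<subseteq># t" using assms by simp
  have "\<not> q \<subseteq># p"
    using assms(1,2,6) by (metis mset_subset_size nat_neq_iff subset_mset.le_less)
  then have "p \<subset># p \<union># q"
    by (metis subset_mset.le_iff_sup subset_mset.le_less subset_mset.sup_commute subset_mset.sup_ge1)
  then have "size p < size (p \<union># q)" by (rule mset_subset_size)
  then have "p \<union># q = t"
    using sub assms(1,3) mset_subset_size[of "p \<union># q" t] by (auto simp: subset_mset.le_less)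
  then show "set_mset t = set_mset p \<union> set_mset q" by auto
  show "set_mset p \<inter> set_mset q \<noteq> {}"
  proof
    assume "set_mset p \<inter> set_mset q = {}"
    then have "p \<inter># q = {#}" by (simp flip: set_mset_inter)
    then have "p \<union># q = p + q" using union_diff_inter_eq_sup[of p q] by simp
    then have "size t = size p + size q" using \<open>p \<union># q = t\<close> by simp
    then show False using assms(1-3) by simp
  qed
qed

lemma minimal_not_packable_card:
  assumes Q: "finite Q" "\<forall>A\<in>Q. A \<subseteq># M \<and> size A \<in> {2, 3}"
    and notpack: "\<not> packable M Q" and min: "\<And>R. R \<subset> Q \<Longrightarrow> packable M R"
  shows "card Q \<le> Delta M + 3"
proof (cases "\<exists>s\<in>Q. size s = 2")
  case False
  then have no_D: "packable M R \<longleftrightarrow> \<Sum>R \<subseteq># M" if "R \<subseteq> Q" for R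
  proof -
    have "D = {}" if "D \<subseteq> {A \<in> R. size A = 2}" for D using False \<open>R \<subseteq> Q\<close> that by blast
    then have "D \<subseteq> {A \<in> R. size A = 2} \<longleftrightarrow> D = {}" for D by blast
    then show ?thesis by (simp add: packable_def)
  qed
  then have "\<not> \<Sum>Q \<subseteq># M" using notpack by blast
  \<comment> \<open>By minimality all triples contain the overloaded element \<open>x\<close>.\<close>
  then obtain x where x: "count M x < count (\<Sum>Q) x"
    by (meson mset_subset_eqI not_le)
  have "{t \<in> Q. x \<in># t} = Q"
  proof (rule ccontr)
    assume "{t \<in> Q. x \<in># t} \<noteq> Q"
    then have "{t \<in> Q. x \<in># t} \<subset> Q" by auto
    then have "\<Sum>{t \<in> Q. x \<in># t} \<subseteq># M" using min no_D by auto
    then have "count (\<Sum>{t \<in> Q. x \<in># t}) x \<le> count M x" by (rule mset_subset_eq_count)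
    moreover have "count (\<Sum>{t \<in> Q. x \<in># t}) x = count (\<Sum>Q) x"
      unfolding count_sum using Q(1) by (intro sum.mono_neutral_left) (auto simp: not_in_iff)
    ultimately show False using x by simp
  qed
  then have xQ: "\<And>t. t \<in> Q \<Longrightarrow> x \<in># t" by blast
  have "Q \<noteq> {}" using x by auto
  \<comment> \<open>The triples other than \<open>t\<close> fit into \<open>M\<close> and each uses
    \<open>x\<close>, so \<open>card Q - 1 \<le> count M x \<le> Delta M + 1\<close>.\<close>
  then obtain t where t: "t \<in> Q" by blast
  then have "Q - {t} \<subset> Q" by blast
  then have "\<Sum>(Q - {t}) \<subseteq># M" using min no_D by blast
  then have "(\<Sum>A\<in>Q - {t}. count A x) \<le> count M x"
    unfolding count_sum[symmetric] by (rule mset_subset_eq_count)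
  moreover have "card (Q - {t}) \<le> (\<Sum>A\<in>Q - {t}. count A x)"
    unfolding card_eq_sum using xQ by (intro sum_mono) (auto simp: Suc_le_eq)
  moreover have "count M x \<le> Delta M + 1"
    using sum_count_le_Delta[of "{x}" M] xQ[OF t] t Q by (auto dest: mset_subset_eqD)
  moreover have "card Q = card (Q - {t}) + 1" using card_Suc_Diff1[OF Q(1) t] by simp
  ultimately show ?thesis by linarith
next
  case True
  then obtain s where s: "s \<in> Q" "size s = 2" by blast
  have size_Q: "size A = 2 \<or> size A = 3" if "A \<in> Q" for A using Q that by auto
  have sub_M: "set_mset A \<subseteq> set_mset M" if "A \<in> Q" for A using Q that by (auto dest: set_mset_mono)
  have "{#} \<notin> Q" using size_Q by fastforce
  define P where "P = {p \<in> Q. size p = 2}"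
  define T0 where "T0 = {t \<in> Q. size t = 3 \<and> (\<forall>p\<in>P. \<not> p \<subseteq># t)}"
  define T2 where "T2 = {t \<in> Q. size t = 3 \<and> (\<exists>p\<in>P. p \<subseteq># t)}"
  have fin: "finite P" "finite T0" "finite T2" using Q by (auto simp: P_def T0_def T2_def)
  have "s \<in> P" using s by (simp add: P_def)
  \<comment> \<open>If \<open>p\<close> were the only pair inside \<open>t\<close>, a packing of
    \<open>Q - {p}\<close> would extend to \<open>Q\<close>.\<close>
  have T2: "\<exists>p\<in>P. \<exists>q\<in>P. p \<noteq> q \<and> p \<subseteq># t \<and> q \<subseteq># t" if t: "t \<in> T2" for t
  proof (rule ccontr)
    assume contr: "\<not> ?thesis"
    obtain p where p: "p \<in> P" "p \<subseteq># t" using t by (auto simp: T2_def)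
    then have "Q - {p} \<subset> Q" by (auto simp: P_def)
    then have "packable M (Q - {p})" by (rule min)
    then have "packable M Q"
      by (rule packable_insert_absorbed[of M Q p t]) (use p t contr in \<open>auto simp: P_def T2_def\<close>)
    then show False using notpack by simp
  qed
  \<comment> \<open>The family \<open>P \<union> T0\<close> already links everything that \<open>Q\<close> links, as a triple of \<open>T2\<close> is the union of
    two intersecting pairs. So a set \<open>Y\<close> maximal with \<open>card Y \<le> w Y\<close> meets no member only partially.\<close>
  define w where "w Y = 1 + card {p \<in> P. set_mset p \<subseteq> Y} + 2 * card {t \<in> T0. set_mset t \<subseteq> Y}" for Y
  define \<Y> where "\<Y> = {Y. set_mset s \<subseteq> Y \<and> Y \<subseteq> set_mset M \<and> card Y \<le> w Y}"
  have card_set: "card (set_mset A) \<le> size A" for A :: "'a multiset"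
    unfolding size_multiset_overloaded_eq card_eq_sum by (intro sum_mono) (auto simp: Suc_le_eq)
  have "finite \<Y>" by (rule finite_subset[of _ "Pow (set_mset M)"]) (auto simp: \<Y>_def)
  \<comment> \<open>\<open>s\<close> itself is counted in \<open>w\<close>, which makes the weight
    at least 2.\<close>
  moreover have "set_mset s \<in> \<Y>"
  proof -
    have "card {s} \<le> card {p \<in> P. set_mset p \<subseteq> set_mset s}"
      using \<open>s \<in> P\<close> fin by (intro card_mono) auto
    then show ?thesis using sub_M[OF s(1)] card_set[of s] s by (simp add: \<Y>_def w_def)
  qed
  ultimately obtain Y where Y: "Y \<in> \<Y>" and Y_max: "\<And>Z. Z \<in> \<Y> \<Longrightarrow> Y \<subseteq> Z \<Longrightarrow> Z = Y"
    using finite_has_maximal[of \<Y>] by (metis empty_iff)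
  have finY: "finite Y" using Y by (auto simp: \<Y>_def intro: finite_subset)
  have closed: "set_mset A \<subseteq> Y" if A: "A \<in> P \<union> T0" "set_mset A \<inter> Y \<noteq> {}" for A
  proof (rule ccontr)
    assume nsub: "\<not> set_mset A \<subseteq> Y"
    let ?Z = "Y \<union> set_mset A"
    have "A \<in> Q" using A by (auto simp: P_def T0_def)
    have "card ?Z + card (Y \<inter> set_mset A) = card Y + card (set_mset A)"
      using card_Un_Int[of Y "set_mset A"] finY by simp
    moreover have "card (Y \<inter> set_mset A) > 0" using A(2) finY by (simp add: card_gt_0_iff Int_commute)
    ultimately have cZ: "card ?Z + 1 \<le> card Y + size A" using card_set[of A] by linarith
    have mono: "card {p \<in> R. set_mset p \<subseteq> Y} + (if A \<in> R then 1 else 0) \<le> card {p \<in> R. set_mset p \<subseteq> ?Z}"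
      if "finite R" for R
    proof (cases "A \<in> R")
      case True
      have "card (insert A {p \<in> R. set_mset p \<subseteq> Y}) \<le> card {p \<in> R. set_mset p \<subseteq> ?Z}"
        using that True by (intro card_mono) auto
      then show ?thesis using True that nsub by simp
    next
      case False
      then show ?thesis using that by (simp, intro card_mono) auto
    qed
    \<comment> \<open>Adding a pair or triple \<open>A\<close> that meets \<open>Y\<close> brings at
      most \<open>size A - 1\<close> new elements, and raises the weight by at least
      \<open>size A - 1\<close>.\<close>
    have "w Y + size A \<le> w ?Z + 1"
    proof (cases "A \<in> P")
      case True
      then have "size A = 2" by (simp add: P_def)
      then show ?thesis using True mono[OF fin(1)] mono[OF fin(2)] by (simp add: w_def split: if_splits)
    next
      case False
      then have "A \<in> T0" "size A = 3" using A by (auto simp: T0_def)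
      then show ?thesis using False mono[OF fin(1)] mono[OF fin(2)] by (simp add: w_def)
    qed
    then have "card ?Z \<le> w ?Z" using cZ Y by (simp add: \<Y>_def)
    then have "?Z \<in> \<Y>" using Y sub_M[OF \<open>A \<in> Q\<close>] by (auto simp: \<Y>_def)
    then show False using Y_max[of ?Z] nsub by blast
  qed
  have dichotomy: "set_mset A \<subseteq> Y \<or> set_mset A \<inter> Y = {}" if "A \<in> Q" for A
  proof (cases "A \<in> T2")
    case True
    \<comment> \<open>As \<open>p\<close> and \<open>q\<close> intersect, either both lie inside
      \<open>Y\<close> or both avoid it.\<close>
    then obtain p q where pq: "p \<in> P" "q \<in> P" "p \<noteq> q" "p \<subseteq># A" "q \<subseteq># A" using T2 by blast
    then have "size p = 2" "size q = 2" "size A = 3" using True by (auto simp: P_def T2_def)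
    from two_pairs_cover_triple[OF this pq(4,5,3)] show ?thesis
      using closed[of p] closed[of q] pq by blast
  next
    case False
    then have "A \<in> P \<union> T0" using size_Q that by (auto simp: P_def T0_def T2_def)
    then show ?thesis using closed by blast
  qed
  \<comment> \<open>Otherwise \<open>Q\<close> falls into two proper subfamilies with separate
    supports, both packable by minimality.\<close>
  have QY: "set_mset A \<subseteq> Y" if "A \<in> Q" for A
  proof (rule ccontr)
    assume A: "\<not> set_mset A \<subseteq> Y"
    let ?Q1 = "{A \<in> Q. set_mset A \<subseteq> Y}"
    have "s \<in> ?Q1" using s Y by (simp add: \<Y>_def)
    then have "?Q1 \<subset> Q" "Q - ?Q1 \<subset> Q" using that A s by auto
    from this[THEN min] have "packable M ?Q1" "packable M (Q - ?Q1)" .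
    then have "packable M (?Q1 \<union> (Q - ?Q1))"
      using Q \<open>{#} \<notin> Q\<close> dichotomy by (intro packable_Un_disjoint[where Y = Y]) auto
    moreover have "?Q1 \<union> (Q - ?Q1) = Q" by blast
    ultimately show False using notpack by simp
  qed
  \<comment> \<open>Compare the number of elements of \<open>M\<close> used by a packing of \<open>Q - {s}\<close> with the bound on \<open>card Y\<close>.\<close>
  have "packable M (Q - {s})" using s by (intro min) auto
  then obtain D f where D: "D \<subseteq> {A \<in> Q - {s}. size A = 2}" "inj_on f D"
    "\<forall>p\<in>D. f p \<in> Q - {s} \<and> size (f p) = 3 \<and> p \<subseteq># f p" "\<Sum>(Q - {s} - D) \<subseteq># M"
    by (auto simp: packable_def)
  have "f ` D \<subseteq> T2" using D by (force simp: T2_def P_def)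
  \<comment> \<open>Each triple takes in at most one pair, and only triples of \<open>T2\<close>
    contain any.\<close>
  then have "card D \<le> card T2" using card_inj_on_le[OF D(2)] fin by blast
  have T: "T0 \<inter> T2 = {}" "(T0 \<union> T2) \<inter> P = {}" "Q = (T0 \<union> T2) \<union> P"
    using size_Q by (auto simp: T0_def T2_def P_def)
  have DP: "insert s D \<subseteq> P" "s \<notin> D" using D(1) s by (auto simp: P_def)
  then have "finite D" using fin finite_subset by auto
  have card_P: "card (P - insert s D) + card D + 1 = card P"
    using card_Diff_subset[of "insert s D" P] card_mono[OF fin(1) DP(1)] DP fin \<open>finite D\<close> by simp
  have split: "Q - {s} - D = (T0 \<union> T2) \<union> (P - insert s D)" using T DP by blast
  have "size (\<Sum>(Q - {s} - D)) = (\<Sum>A\<in>Q - {s} - D. size A)" by (rule size_sum)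
  also have "\<dots> = (\<Sum>A\<in>T0 \<union> T2. size A) + (\<Sum>A\<in>P - insert s D. size A)"
    unfolding split using fin T by (intro sum.union_disjoint) auto
  also have "(\<Sum>A\<in>T0 \<union> T2. size A) = (\<Sum>A\<in>T0 \<union> T2. 3)"
    by (intro sum.cong) (auto simp: T0_def T2_def)
  also have "(\<Sum>A\<in>P - insert s D. size A) = (\<Sum>A\<in>P - insert s D. 2)"
    by (intro sum.cong) (auto simp: P_def)
  finally have size_eq: "size (\<Sum>(Q - {s} - D)) = 3 * (card T0 + card T2) + 2 * card (P - insert s D)"
    using T fin by (simp add: card_Un_disjoint)
  have "size (\<Sum>(Q - {s} - D)) = (\<Sum>x\<in>Y. count (\<Sum>(Q - {s} - D)) x)"
  proof -
    have "set_mset (\<Sum>(Q - {s} - D)) \<subseteq> Y" using QY Q(1) by (auto simp: set_mset_sum)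
    then show ?thesis
      unfolding size_multiset_overloaded_eq
      by (intro sum.mono_neutral_left finY ballI) (simp_all only: Diff_iff not_in_iff)
  qed
  also have "\<dots> \<le> (\<Sum>x\<in>Y. count M x)"
    using D(4) by (intro sum_mono mset_subset_eq_count)
  also have "\<dots> \<le> Delta M + card Y"
    using Y by (intro sum_count_le_Delta) (auto simp: \<Y>_def)
  also have "card Y \<le> w Y" using Y by (simp add: \<Y>_def)
  also have "w Y \<le> 1 + card P + 2 * card T0"
    unfolding w_def using fin by (intro add_mono mult_left_mono card_mono) auto
  finally have "3 * (card T0 + card T2) + 2 * card (P - insert s D)
    \<le> Delta M + (1 + card P + 2 * card T0)" using size_eq by simp
  moreover have "card Q = card T0 + card T2 + card P"
    using T fin by (simp add: card_Un_disjoint)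
  \<comment> \<open>Eliminating \<open>P - insert s D\<close> gives \<open>card T0 + 3 * card T2 +
    card P \<le> Delta M + 3 + 2 * card D\<close>, where 2 of the 3 stem from omitting
    \<open>s\<close> and 1 from the bound on \<open>card Y\<close>; then
    \<open>card D \<le> card T2\<close> applies.\<close>
  ultimately show ?thesis using card_P \<open>card D \<le> card T2\<close>
    unfolding distrib_left by linarith
qed

text \<open>An inclusion-minimal subfamily without a packing would be small enough to be packable by
  assumption.\<close>

lemma packable_if_small_subsets_packable:
  assumes Q: "small_sides M Q" and small: "\<And>R. R \<subseteq> Q \<Longrightarrow> card R \<le> Delta M + 3 \<Longrightarrow> packable M R"
  shows "packable M Q"
proof (rule ccontr)
  let ?N = "{R \<in> Pow Q. \<not> packable M R}"
  assume "\<not> packable M Q"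
  moreover have fin: "finite Q" using Q by (simp add: small_sides_def)
  ultimately have "?N \<noteq> {}" "finite ?N" by auto
  from finite_has_minimal[OF this(2,1)] obtain R
    where R: "R \<subseteq> Q" "\<not> packable M R" and min: "\<forall>R'\<in>?N. R' \<subseteq> R \<longrightarrow> R = R'"
    by blast
  have "packable M R'" if "R' \<subset> R" for R' using min that R(1) by blast
  have "finite R" "\<forall>A\<in>R. A \<subseteq># M \<and> size A \<in> {2, 3}"
    using R(1) Q fin by (auto simp: small_sides_def intro: finite_subset)
  then have "card R \<le> Delta M + 3"
    using R(2) \<open>\<And>R'. R' \<subset> R \<Longrightarrow> packable M R'\<close> by (rule minimal_not_packable_card)
  then show False using small R by blast
qed

lemma mset_set_set_mset_count_one:
  assumes "\<forall>s\<in>#S. count S s = 1"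
  shows "mset_set (set_mset S) = S"
  using assms by (intro multiset_eqI) (metis count_mset_set(1,3) finite_set_mset not_in_iff)

subsection \<open>The main theorem\<close>

text \<open>A side of minimum size is chosen for every split. The side determines the split, which
  yields injectivity, and multiplicity one makes \<open>S\<close> recoverable from its set of
  splits.\<close>

lemma small_sides_exist:
  assumes S: "split_system_23 M S" and mult: "\<forall>s\<in>#S. count S s = 1"
  shows "\<exists>Q. small_sides M Q \<and> S = image_mset (split_of M) (mset_set Q)"
proof -
  have "\<exists>A. s = split_of M A \<and> A \<subseteq># M \<and> size A \<in> {2, 3} \<and> 2 * size A \<le> size M" if s: "s \<in># S" for s
  proof -
    have "is_split M s" "split_size s \<in> {2, 3}"
      using S s unfolding split_system_23_def split_system_def by blast+
    then obtain A B where AB: "s = Upair A B" "A + B = M" unfolding is_split_def by blast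
    have "min (size A) (size B) \<in> {2, 3}"
      using \<open>split_size s \<in> {2, 3}\<close> AB(1) by (simp add: split_size_def)
    moreover have "s = split_of M A" "s = split_of M B" "A \<subseteq># M" "B \<subseteq># M" "size M = size A + size B"
      unfolding AB(2)[symmetric] AB(1) by auto
    ultimately show ?thesis by (metis add_le_mono mult_2 min_def nat_le_linear order_refl)
  qed
  then have "\<forall>s\<in>set_mset S. \<exists>A. s = split_of M A \<and> A \<subseteq># M \<and> size A \<in> {2, 3} \<and> 2 * size A \<le> size M"
    by (intro ballI)
  from bchoice[OF this] obtain h where "\<forall>s\<in>set_mset S. s = split_of M (h s) \<and> h s \<subseteq># M
      \<and> size (h s) \<in> {2, 3} \<and> 2 * size (h s) \<le> size M" ..
  then have h: "\<And>s. s \<in># S \<Longrightarrow> split_of M (h s) = s"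
    "\<And>s. s \<in># S \<Longrightarrow> h s \<subseteq># M \<and> size (h s) \<in> {2, 3} \<and> 2 * size (h s) \<le> size M"
    by (metis, metis)
  let ?Q = "h ` set_mset S"
  have inj: "inj_on (split_of M) ?Q"
  proof (rule inj_onI)
    fix A B assume "A \<in> ?Q" "B \<in> ?Q" and eq: "split_of M A = split_of M B"
    then obtain s t where "s \<in># S" "t \<in># S" "A = h s" "B = h t" by blast
    then show "A = B" using eq h(1) by metis
  qed
  then have "small_sides M ?Q" using h(2) unfolding small_sides_def by simp
  moreover have "split_of M ` ?Q = set_mset S"
    unfolding image_image using h(1) by simp
  then have "image_mset (split_of M) (mset_set ?Q) = mset_set (set_mset S)"
    using image_mset_mset_set[OF inj] by simp
  moreover have "mset_set (set_mset S) = S"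
    by (rule mset_set_set_mset_count_one[OF mult])
  ultimately show ?thesis by metis
qed

theorem theorem6:
  fixes M :: "'a multiset" and S :: "'a multiset uprod multiset"
  assumes "split_system_23 M S"
    and "\<forall>s\<in>#S. count S s = 1"
  shows "compatible M S \<longleftrightarrow>
    (\<forall>S'. S' \<subseteq># S \<and> size S' \<le> Delta M + 3 \<longrightarrow> compatible M S')"
proof -
  let ?sys = "\<lambda>Q. image_mset (split_of M) (mset_set Q)"
  obtain Q where Q: "small_sides M Q" and S: "S = ?sys Q"
    using small_sides_exist[OF assms] by blast
  have fin: "finite Q" using Q by (simp add: small_sides_def)
  show ?thesis
  proof (intro iffI allI impI)
    fix S' assume comp: "compatible M S" and S': "S' \<subseteq># S \<and> size S' \<le> Delta M + 3"
    define R where "R = {A \<in> Q. split_of M A \<in># S'}"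
    have "R \<subseteq> Q" by (auto simp: R_def)
    then have R: "small_sides M R" by (rule small_sides_subset[OF Q])
    have "set_mset S' \<subseteq> set_mset S" using S' by (simp add: set_mset_mono)
    then have "split_of M ` R = set_mset S'" unfolding S R_def using fin by auto
    moreover have "inj_on (split_of M) R" using R by (simp add: small_sides_def)
    ultimately have "?sys R = mset_set (set_mset S')" by (metis image_mset_mset_set)
    moreover have "count S' s = 1" if "s \<in># S'" for s
    proof -
      have "0 < count S' s" using that by simp
      moreover have "count S' s \<le> count S s" using S' by (simp add: mset_subset_eq_count)
      moreover have "count S s = 1" using assms(2) S' that by (meson mset_subset_eqD)
      ultimately show ?thesis by linarith
    qed
    ultimately have "?sys R = S'" using mset_set_set_mset_count_one by metis
    \<comment> \<open>Restricting the vertex sets found for \<open>Q\<close> replaces contracting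
      the edges of the tree outside \<open>S'\<close>.\<close>
    moreover have "packable M R"
      using comp compatible_imp_realises[OF Q] realises_subset[OF _ \<open>R \<subseteq> Q\<close>]
        realises_imp_packable[OF R] unfolding S by blast
    ultimately show "compatible M S'" using packable_imp_compatible[OF R] by simp
  next
    assume small: "\<forall>S'. S' \<subseteq># S \<and> size S' \<le> Delta M + 3 \<longrightarrow> compatible M S'"
    have "packable M R" if R: "R \<subseteq> Q" "card R \<le> Delta M + 3" for R
    proof -
      have "?sys R \<subseteq># S" unfolding S using R fin
        by (intro image_mset_subseteq_mono) (simp add: subset_imp_msubset_mset_set)
      then have "compatible M (?sys R)" using small R by simp
      then show ?thesis using compatible_iff_packable small_sides_subset[OF Q R(1)] by blast
    qed
    then have "packable M Q" by (rule packable_if_small_subsets_packable[OF Q])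
    then show "compatible M S" unfolding S using compatible_iff_packable[OF Q] by blast
  qed
qed

end
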